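(* The functor $L\colon\mathit{DTop}\to\mathit{DTop}$, $(X,dX)\mapsto(X,\hat dX)$ (identity on underlying maps), with $\eta^L_X\colon X\to LX$ given by the identity map, is maximal among d-saturation processes: it is a d-saturation process, and $S\le L$ for every d-saturation process $S$.
   Context: Let $I=[0,1]$. A d-space is a pair $(X,dX)$ of a topological space $X$ and a set $dX$ of continuous maps $I\to X$ (called directed paths) such that constant paths are in $dX$, $dX$ is stable under concatenation, and $dX$ is stable under precomposition with continuous non-decreasing maps $I\to I$. A morphism $(X,dX)\to(Y,dY)$ is a continuous map $f\colon X\to Y$ with $f\circ p\in dY$ for all $p\in dX$. This gives the category $\mathit{DTop}$, with its forgetful functor to the category $\mathit{Top}$ of topological spaces. Let $\mathbb I$ be the d-space with underlying space $I$ whose directed paths are the non-decreasing continuous maps $I\to I$. A subspace $Y\subseteq X$ of a d-space inherits a d-space structure: its directed paths are the directed paths of $X$ with image in $Y$; when $Y$ is open in $X$ it is called an open subspace. A directed function on an open subspace $U\subseteq X$ is a morphism of d-spaces $U\to\mathbb I$. A path (continuous map) $c\colon I\to X$ is weakly directed if for every open subspace $U\subseteq X$ and every directed function $f$ on $U$, the map $f\circ c\colon c^{-1}(U)\to I$ is locally non-decreasing (every point of $c^{-1}(U)$ has a neighbourhood in $c^{-1}(U)$ on which it is non-decreasing). The set of weakly directed paths in $X$ is denoted $\hat dX$. A d-saturation process is a functor $S\colon\mathit{DTop}\to\mathit{DTop}$ which commutes with the forgetful functor $\mathit{DTop}\to\mathit{Top}$, equipped with a natural transformation $\eta^S\colon\mathrm{id}\to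 S$ such that: (1) $\eta^S$ is mapped to the identity by the forgetful functor to $\mathit{Top}$; (2) its component $\eta^S_{\mathbb I}\colon\mathbb I\to S\mathbb I$ at $\mathbb I$ is the identity; (3) (locality) for any d-space $X$ and subspace $Y\subseteq X$, directed paths in $SX$ with image contained in $Y$ are also directed in $SY$. For d-saturation processes $S,T$, one writes $S\le T$ if for each d-space $X$ the set-theoretic identity of $X$ is a morphism of d-spaces from $SX$ to $TX$.
   Formalization: Locality (3) is required only for open subspaces Y: for arbitrary Y, L fails it (plane with vertical paths and horizontal paths at nonzero height, Y the horizontal axis). DTop consists of the d-spaces with points in an arbitrary fixed type into which the interval embeds. *)

theory Defs
  imports "HOL-Analysis.Analysis"
begin

text \<open>
  A d-space is a topology together with its set of directed paths. Paths are functions on the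
  unit interval, represented as elements of \<open>extensional {0..1}\<close>, so that equality of paths
  is equality on the interval; likewise for morphisms and the underlying set of their domain.
\<close>

type_synonym 'a dspace = "'a topology \<times> (real \<Rightarrow> 'a) set"

abbreviation top_of :: "'a dspace \<Rightarrow> 'a topology" where
  "top_of \<equiv> fst"

abbreviation dpaths :: "'a dspace \<Rightarrow> (real \<Rightarrow> 'a) set" where
  "dpaths \<equiv> snd"

abbreviation carrier :: "'a dspace \<Rightarrow> 'a set" where
  "carrier X \<equiv> topspace (top_of X)"

definition paths :: "'a topology \<Rightarrow> (real \<Rightarrow> 'a) set" where
  "paths T = {p \<in> extensional {0..1}. pathin T p}"

definition path_concat :: "(real \<Rightarrow> 'a) \<Rightarrow> (real \<Rightarrow> 'a) \<Rightarrow> real \<Rightarrow> 'a" where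
  "path_concat p q = (\<lambda>t\<in>{0..1}. if t \<le> 1/2 then p (2 * t) else q (2 * t - 1))"

definition reparametrization :: "(real \<Rightarrow> real) \<Rightarrow> bool" where
  "reparametrization \<phi> \<longleftrightarrow>
     continuous_on {0..1} \<phi> \<and> \<phi> \<in> {0..1} \<rightarrow> {0..1} \<and> mono_on {0..1} \<phi>"

definition dspace :: "'a dspace \<Rightarrow> bool" where
  "dspace X \<longleftrightarrow>
     dpaths X \<subseteq> paths (top_of X) \<and>
     (\<forall>x\<in>carrier X. (\<lambda>t\<in>{0..1}. x) \<in> dpaths X) \<and>
     (\<forall>p\<in>dpaths X. \<forall>q\<in>dpaths X. p 1 = q 0 \<longrightarrow> path_concat p q \<in> dpaths X) \<and>
     (\<forall>p\<in>dpaths X. \<forall>\<phi>. reparametrization \<phi> \<longrightarrow> compose {0..1} p \<phi> \<in> dpaths X)"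

definition dhom :: "'a dspace \<Rightarrow> 'b dspace \<Rightarrow> ('a \<Rightarrow> 'b) set" where
  "dhom X Y = {f \<in> extensional (carrier X).
     continuous_map (top_of X) (top_of Y) f \<and>
     (\<forall>p\<in>dpaths X. compose {0..1} f p \<in> dpaths Y)}"

definition id_map :: "'a dspace \<Rightarrow> 'a \<Rightarrow> 'a" where
  "id_map X = (\<lambda>x\<in>carrier X. x)"

definition subdspace :: "'a dspace \<Rightarrow> 'a set \<Rightarrow> 'a dspace" where
  "subdspace X Y = (subtopology (top_of X) Y, {p \<in> dpaths X. p ` {0..1} \<subseteq> Y})"

definition dinterval :: "real dspace" where
  "dinterval = (top_of_set {0..1}, {p \<in> paths (top_of_set {0..1}). mono_on {0..1} p})"

definition directed_function :: "'a dspace \<Rightarrow> 'a set \<Rightarrow> ('a \<Rightarrow> real) \<Rightarrow> bool" where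
  "directed_function X U f \<longleftrightarrow> f \<in> dhom (subdspace X U) dinterval"

definition locally_nondecreasing_on :: "real set \<Rightarrow> (real \<Rightarrow> real) \<Rightarrow> bool" where
  "locally_nondecreasing_on A g \<longleftrightarrow>
     (\<forall>t\<in>A. \<exists>N. openin (top_of_set A) N \<and> t \<in> N \<and> mono_on N g)"

definition weakly_directed :: "'a dspace \<Rightarrow> (real \<Rightarrow> 'a) \<Rightarrow> bool" where
  "weakly_directed X c \<longleftrightarrow> c \<in> paths (top_of X) \<and>
     (\<forall>U f. openin (top_of X) U \<and> directed_function X U f \<longrightarrow>
        locally_nondecreasing_on {t \<in> {0..1}. c t \<in> U} (f \<circ> c))"

text \<open>
  A functor has to act on all d-spaces at once, so the category is taken to consist of the
  d-spaces with points in an arbitrary fixed type \<open>'u\<close>, which plays the role of the universe of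
  small sets. An injection \<open>\<iota> :: real \<Rightarrow> 'u\<close> on the interval makes \<open>'u\<close> large enough to contain
  the directed interval, namely as the following d-space on \<open>\<iota> ` {0..1}\<close>, obtained
  by transporting the structure of \<open>dinterval\<close> along \<open>\<iota>\<close>.
\<close>

definition dinterval_in :: "(real \<Rightarrow> 'u) \<Rightarrow> 'u dspace" where
  "dinterval_in \<iota> =
     (pullback_topology (\<iota> ` {0..1}) (inv_into {0..1} \<iota>) (top_of dinterval),
      compose {0..1} \<iota> ` dpaths dinterval)"

text \<open>An endofunctor is given by its action on objects and on the arrows of each hom-set.\<close>

record 'u dfunctor =
  Ob :: "'u dspace \<Rightarrow> 'u dspace"
  Ar :: "'u dspace \<Rightarrow> 'u dspace \<Rightarrow> ('u \<Rightarrow> 'u) \<Rightarrow> ('u \<Rightarrow> 'u)"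

definition endofunctor :: "'u dfunctor \<Rightarrow> bool" where
  "endofunctor S \<longleftrightarrow>
     (\<forall>X. dspace X \<longrightarrow> dspace (Ob S X)) \<and>
     (\<forall>X Y f. dspace X \<and> dspace Y \<and> f \<in> dhom X Y \<longrightarrow> Ar S X Y f \<in> dhom (Ob S X) (Ob S Y)) \<and>
     (\<forall>X. dspace X \<longrightarrow> Ar S X X (id_map X) = id_map (Ob S X)) \<and>
     (\<forall>X Y Z f g. dspace X \<and> dspace Y \<and> dspace Z \<and> f \<in> dhom X Y \<and> g \<in> dhom Y Z \<longrightarrow>
        Ar S X Z (compose (carrier X) g f) =
          compose (carrier (Ob S X)) (Ar S Y Z g) (Ar S X Y f))"

definition commutes_with_forgetful :: "'u dfunctor \<Rightarrow> bool" where
  "commutes_with_forgetful S \<longleftrightarrow>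
     (\<forall>X. dspace X \<longrightarrow> top_of (Ob S X) = top_of X) \<and>
     (\<forall>X Y f. dspace X \<and> dspace Y \<and> f \<in> dhom X Y \<longrightarrow> Ar S X Y f = f)"

definition natural_from_id :: "'u dfunctor \<Rightarrow> ('u dspace \<Rightarrow> 'u \<Rightarrow> 'u) \<Rightarrow> bool" where
  "natural_from_id S \<eta> \<longleftrightarrow>
     (\<forall>X. dspace X \<longrightarrow> \<eta> X \<in> dhom X (Ob S X)) \<and>
     (\<forall>X Y f. dspace X \<and> dspace Y \<and> f \<in> dhom X Y \<longrightarrow>
        compose (carrier X) (Ar S X Y f) (\<eta> X) = compose (carrier X) (\<eta> Y) f)"

text \<open>
  The subspaces in the locality condition are the open ones. With arbitrary subspaces
  it fails for weakly directed paths. For example, let \<open>X\<close> be the plane, with directed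
  paths the finite concatenations of vertical paths and of horizontal paths at nonzero height
  (all in either direction). Directed functions on open sets are then locally constant, hence every
  path in \<open>X\<close> is weakly directed; but the horizontal axis, as a d-subspace, has only constant
  directed paths, and hence only constant weakly directed paths.

  That the unit at the interval is the identity morphism includes the equality of its
  source and target.
\<close>

definition d_saturation_process ::
  "(real \<Rightarrow> 'u) \<Rightarrow> 'u dfunctor \<Rightarrow> ('u dspace \<Rightarrow> 'u \<Rightarrow> 'u) \<Rightarrow> bool" where
  "d_saturation_process \<iota> S \<eta> \<longleftrightarrow>
     endofunctor S \<and> commutes_with_forgetful S \<and> natural_from_id S \<eta> \<and>
     (\<forall>X. dspace X \<longrightarrow> \<eta> X = id_map X) \<and>
     Ob S (dinterval_in \<iota>) = dinterval_in \<iota> \<and>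
     \<eta> (dinterval_in \<iota>) = id_map (dinterval_in \<iota>) \<and>
     (\<forall>X Y p. dspace X \<and> openin (top_of X) Y \<and>
        p \<in> dpaths (Ob S X) \<and> p ` {0..1} \<subseteq> Y \<longrightarrow> p \<in> dpaths (Ob S (subdspace X Y)))"

definition saturation_le :: "'u dfunctor \<Rightarrow> 'u dfunctor \<Rightarrow> bool" where
  "saturation_le S T \<longleftrightarrow> (\<forall>X. dspace X \<longrightarrow> id_map X \<in> dhom (Ob S X) (Ob T X))"

definition L_functor :: "'u dfunctor" where
  "L_functor = \<lparr>Ob = (\<lambda>X. (top_of X, {c. weakly_directed X c})), Ar = (\<lambda>X Y f. f)\<rparr>"

definition L_unit :: "'u dspace \<Rightarrow> 'u \<Rightarrow> 'u" where
  "L_unit X = id_map X"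

end

theory Submission
  imports Defs
begin

text \<open>
  Let \<open>p\<close> be directed in \<open>S X\<close> and let \<open>f\<close> be a directed function on an open \<open>U\<close>. A piece of \<open>p\<close> that
  runs inside \<open>U\<close> is directed in \<open>S X\<close>, hence by locality in \<open>S U\<close>; since \<open>S\<close> fixes the directed interval,
  functoriality makes \<open>f\<close> a morphism from \<open>S U\<close> to the interval, so \<open>f\<close> is non-decreasing along that piece.
  Such pieces cover the preimage of \<open>U\<close>, so \<open>p\<close> is weakly directed. That \<open>L\<close> fixes the interval holds
  because a locally non-decreasing function on an interval is non-decreasing.
\<close>

section \<open>Local monotonicity on sets of reals\<close>

text \<open>Relatively open neighbourhoods can be replaced by traces of balls. In the metric form,
  neighbourhoods are combined by taking minima of radii and transported along maps of the time
  parameter by rescaling or continuity.\<close>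

lemma locally_nondecreasing_on_iff:
  "locally_nondecreasing_on A g \<longleftrightarrow>
     (\<forall>t\<in>A. \<exists>e>0. \<forall>s\<in>A. \<forall>s'\<in>A. \<bar>s - t\<bar> < e \<longrightarrow> \<bar>s' - t\<bar> < e \<longrightarrow> s \<le> s' \<longrightarrow> g s \<le> g s')"
    (is "?L \<longleftrightarrow> ?R")
proof
  assume L: ?L
  show ?R
  proof
    fix t assume "t \<in> A"
    then obtain N where N: "openin (top_of_set A) N" "t \<in> N" "mono_on N g"
      using L unfolding locally_nondecreasing_on_def by blast
    then obtain e where "e > 0" "ball t e \<inter> A \<subseteq> N"
      unfolding openin_contains_ball by blast
    with N(3) show "\<exists>e>0. \<forall>s\<in>A. \<forall>s'\<in>A. \<bar>s - t\<bar> < e \<longrightarrow> \<bar>s' - t\<bar> < e \<longrightarrow> s \<le> s' \<longrightarrow> g s \<le> g s'"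
      by (intro exI[of _ e]) (auto simp: mono_on_def dist_real_def abs_minus_commute subset_iff)
  qed
next
  assume R: ?R
  show ?L
    unfolding locally_nondecreasing_on_def
  proof
    fix t assume t: "t \<in> A"
    then obtain e where "e > 0"
      and e: "\<forall>s\<in>A. \<forall>s'\<in>A. \<bar>s - t\<bar> < e \<longrightarrow> \<bar>s' - t\<bar> < e \<longrightarrow> s \<le> s' \<longrightarrow> g s \<le> g s'"
      using R by blast
    then have "mono_on (A \<inter> ball t e) g"
      by (auto simp: mono_on_def dist_real_def abs_minus_commute)
    with t \<open>e > 0\<close> show "\<exists>N. openin (top_of_set A) N \<and> t \<in> N \<and> mono_on N g"
      by (intro exI[of _ "A \<inter> ball t e"]) auto
  qed
qed

text \<open>Bisection: the inequality between the end values passes from two adjacent intervals to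
  their union, and it holds on all short enough intervals around each point.\<close>

lemma locally_nondecreasing_on_imp_mono_on:
  assumes "locally_nondecreasing_on {a..b} g"
  shows "mono_on {a..b} g"
proof (rule mono_onI)
  fix r s :: real assume rs: "r \<in> {a..b}" "s \<in> {a..b}" "r \<le> s"
  from \<open>r \<le> s\<close> have "a \<le> r \<longrightarrow> s \<le> b \<longrightarrow> g r \<le> g s"
  \<comment> \<open>The short intervals around a point may stick out of \<open>{a..b}\<close>, where
    nothing is known about \<open>g\<close>. This is why the bounds \<open>a\<close> and
    \<open>b\<close> are premises inside the property being bisected.\<close>
  proof (induction rule: Bolzano)
    case (trans u v w)
    then show ?case by (meson order_trans)
  next
    case (local x)
    then have "x \<in> {a..b}" using rs by auto
    then obtain e where e: "e > 0" "\<forall>s\<in>{a..b}. \<forall>s'\<in>{a..b}. \<bar>s - x\<bar> < e \<longrightarrow> \<bar>s' - x\<bar> < e \<longrightarrow> s \<le> s' \<longrightarrow> g s \<le> g s'"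
      using assms unfolding locally_nondecreasing_on_iff by blast
    show ?case
    proof (intro exI conjI allI impI)
      fix u v assume "u \<le> x \<and> x \<le> v \<and> v - u < e" "a \<le> u" "v \<le> b"
      then show "g u \<le> g v" using e(2) by auto
    qed (use e in auto)
  qed
  with rs show "g r \<le> g s" by auto
qed

section \<open>Paths, reparametrization and concatenation\<close>

lemma paths_ball:
  assumes "c \<in> paths T" "openin T U" "t \<in> {0..1}" "c t \<in> U"
  obtains e where "e > 0" "\<And>s. s \<in> {0..1} \<Longrightarrow> \<bar>s - t\<bar> < e \<Longrightarrow> c s \<in> U"
proof -
  have "openin (top_of_set {0..1}) {s \<in> {0..1}. c s \<in> U}"
    using assms(1,2) openin_continuous_map_preimage[of "top_of_set {0..1}" T c U]
    by (simp add: paths_def pathin_def)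
  then obtain e where "e > 0" "ball t e \<inter> {0..1} \<subseteq> {s \<in> {0..1}. c s \<in> U}"
    using assms(3,4) unfolding openin_contains_ball by blast
  then show ?thesis
    by (intro that[of e]) (auto simp: dist_real_def abs_minus_commute subset_iff)
qed

lemma paths_in_topspace: "c \<in> paths T \<Longrightarrow> t \<in> {0..1} \<Longrightarrow> c t \<in> topspace T"
  using path_image_subset_topspace[of T c] unfolding paths_def by (simp add: Pi_iff)

lemma reparametrizationD:
  assumes "reparametrization \<phi>"
  shows "continuous_on {0..1} \<phi>" "t \<in> {0..1} \<Longrightarrow> \<phi> t \<in> {0..1}" "mono_on {0..1} \<phi>"
  using assms unfolding reparametrization_def by auto

text \<open>Precomposition with this map cuts out the piece of a path between the times
  \<open>a\<close> and \<open>b\<close>, rescaled to the unit interval.\<close>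

lemma reparametrization_affine:
  assumes "0 \<le> a" "a \<le> b" "b \<le> 1"
  shows "reparametrization (\<lambda>s. a + (b - a) * s)"
  unfolding reparametrization_def
proof (intro conjI)
  show "(\<lambda>s. a + (b - a) * s) \<in> {0..1} \<rightarrow> {0..1}"
  proof
    fix s :: real assume "s \<in> {0..1}"
    then have "0 \<le> (b - a) * s" "(b - a) * s \<le> (b - a) * 1"
      using assms by (auto intro!: mult_left_mono simp del: mult_1_right)
    then show "a + (b - a) * s \<in> {0..1}" using assms by auto
  qed
  show "mono_on {0..1} (\<lambda>s. a + (b - a) * s)"
    using assms by (auto intro!: mono_onI mult_left_mono)
qed (intro continuous_intros)

lemma paths_const: "x \<in> topspace T \<Longrightarrow> (\<lambda>t\<in>{0..1}. x) \<in> paths T"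
  unfolding paths_def pathin_def by (simp add: continuous_map_eq[of _ _ "\<lambda>_. x"])

lemma paths_compose:
  assumes "p \<in> paths T" "continuous_map T T' f"
  shows "compose {0..1} f p \<in> paths T'"
proof -
  have "continuous_map (top_of_set {0..1}) T' (f \<circ> p)"
    using assms unfolding paths_def pathin_def by (auto intro: continuous_map_compose)
  then show ?thesis
    unfolding paths_def pathin_def
    by (auto simp: compose_def intro: continuous_map_eq)
qed

lemma paths_reparametrization:
  assumes "p \<in> paths T" "reparametrization \<phi>"
  shows "compose {0..1} p \<phi> \<in> paths T"
proof -
  have "continuous_map (top_of_set {0..1}) (top_of_set {0..1}) \<phi>"
    using assms(2) unfolding reparametrization_def by auto
  moreover have "continuous_map (top_of_set {0..1}) T p"
    using assms(1) by (simp add: paths_def pathin_def)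
  ultimately have "continuous_map (top_of_set {0..1}) T (p \<circ> \<phi>)"
    by (rule continuous_map_compose)
  then show ?thesis
    unfolding paths_def pathin_def
    by (auto simp: compose_def intro: continuous_map_eq)
qed

text \<open>Pasting: both halves of the interval are closed, the two pieces are continuous on them,
  and they agree at the common time 1/2.\<close>

lemma paths_path_concat:
  assumes p: "p \<in> paths T" and q: "q \<in> paths T" and "p 1 = q 0"
  shows "path_concat p q \<in> paths T"
proof -
  let ?I = "top_of_set {0..1::real}"
  have 1: "continuous_map (subtopology ?I {x \<in> topspace ?I. x \<le> 1/2}) T (p \<circ> (\<lambda>t. 2 * t))"
    using p unfolding paths_def pathin_def
    by (intro continuous_map_compose[of _ ?I])
       (auto simp: subtopology_subtopology intro!: continuous_intros)
  have 2: "continuous_map (subtopology ?I {x \<in> topspace ?I. 1/2 \<le> x}) T (q \<circ> (\<lambda>t. 2 * t - 1))"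
    using q unfolding paths_def pathin_def
    by (intro continuous_map_compose[of _ ?I])
       (auto simp: subtopology_subtopology intro!: continuous_intros)
  have "continuous_map ?I T
      (\<lambda>t. if t \<le> 1/2 then (p \<circ> (\<lambda>t. 2 * t)) t else (q \<circ> (\<lambda>t. 2 * t - 1)) t)"
  proof (rule continuous_map_cases_le[OF _ _ 1 2])
    fix t :: real assume "t = 1/2"
    then have "2 * t = 1" by simp
    with assms(3) show "(p \<circ> (\<lambda>t. 2 * t)) t = (q \<circ> (\<lambda>t. 2 * t - 1)) t" by simp
  qed auto
  then show ?thesis
    unfolding paths_def pathin_def path_concat_def
    by (auto intro: continuous_map_eq)
qed

text \<open>The definition assigns the time 1/2 to the first path. When the endpoints match, the
  formula for the second path is valid there too, so each half can be treated as a closed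
  interval.\<close>

lemma path_concat_apply:
  "t \<in> {0..1} \<Longrightarrow> t \<le> 1/2 \<Longrightarrow> path_concat p q t = p (2 * t)"
  "p 1 = q 0 \<Longrightarrow> t \<in> {0..1} \<Longrightarrow> 1/2 \<le> t \<Longrightarrow> path_concat p q t = q (2 * t - 1)"
proof -
  assume *: "p 1 = q 0" "t \<in> {0..1}" "1/2 \<le> t"
  show "path_concat p q t = q (2 * t - 1)"
  proof (cases "t = 1/2")
    case True
    then have "2 * t = 1" by simp
    with True *(1) show ?thesis by (simp add: path_concat_def)
  qed (use * in \<open>simp add: path_concat_def\<close>)
qed (auto simp: path_concat_def)

section \<open>d-spaces, their morphisms and subspaces\<close>

lemma dspaceD:
  assumes "dspace X"
  shows "p \<in> dpaths X \<Longrightarrow> p \<in> paths (top_of X)"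
    and "x \<in> carrier X \<Longrightarrow> (\<lambda>t\<in>{0..1}. x) \<in> dpaths X"
    and "p \<in> dpaths X \<Longrightarrow> q \<in> dpaths X \<Longrightarrow> p 1 = q 0 \<Longrightarrow> path_concat p q \<in> dpaths X"
    and "p \<in> dpaths X \<Longrightarrow> reparametrization \<phi> \<Longrightarrow> compose {0..1} p \<phi> \<in> dpaths X"
  using assms unfolding dspace_def by auto

lemma dhomD:
  assumes "f \<in> dhom X Y"
  shows "f \<in> extensional (carrier X)" "continuous_map (top_of X) (top_of Y) f"
    "p \<in> dpaths X \<Longrightarrow> compose {0..1} f p \<in> dpaths Y"
    "x \<in> carrier X \<Longrightarrow> f x \<in> carrier Y"
  using assms unfolding dhom_def by (auto simp: continuous_map_def)

text \<open>The hypothesis on \<open>dpaths X\<close> keeps the values of directed paths in the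
  carrier, where the extensional composite agrees with applying \<open>f\<close> and then
  \<open>g\<close>.\<close>

lemma dhom_compose:
  assumes f: "f \<in> dhom X Y" and g: "g \<in> dhom Y Z" and X: "dpaths X \<subseteq> paths (top_of X)"
  shows "compose (carrier X) g f \<in> dhom X Z"
  unfolding dhom_def
proof (intro CollectI conjI ballI)
  show "continuous_map (top_of X) (top_of Z) (compose (carrier X) g f)"
    using continuous_map_compose[OF dhomD(2)[OF f] dhomD(2)[OF g]]
    by (rule continuous_map_eq) (simp add: compose_def)
  fix p assume p: "p \<in> dpaths X"
  have "compose {0..1} (compose (carrier X) g f) p = compose {0..1} g (compose {0..1} f p)"
    using paths_in_topspace[of p "top_of X"] p X by (auto simp: compose_def restrict_def fun_eq_iff)
  then show "compose {0..1} (compose (carrier X) g f) p \<in> dpaths Z"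
    using dhomD(3)[OF g dhomD(3)[OF f p]] by simp
qed auto

lemma id_map_dhom:
  assumes "top_of X = top_of Y" "dpaths X \<subseteq> dpaths Y" "dpaths X \<subseteq> paths (top_of X)"
  shows "id_map X \<in> dhom X Y"
  unfolding dhom_def
proof (intro CollectI conjI ballI)
  show "continuous_map (top_of X) (top_of Y) (id_map X)"
    using assms(1) by (auto simp: id_map_def intro: continuous_map_eq[OF continuous_map_id])
  fix p assume p: "p \<in> dpaths X"
  then have "p \<in> paths (top_of X)" using assms(3) by blast
  then have "compose {0..1} (id_map X) p = p"
    using paths_in_topspace[of p "top_of X"] unfolding id_map_def
    by (intro Id_compose) (auto simp: paths_def)
  with p assms show "compose {0..1} (id_map X) p \<in> dpaths Y" by auto
qed (simp add: id_map_def)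

lemma subdspace_simps [simp]:
  "top_of (subdspace X U) = subtopology (top_of X) U"
  "dpaths (subdspace X U) = {p \<in> dpaths X. p ` {0..1} \<subseteq> U}"
  by (auto simp: subdspace_def)

lemma paths_subtopology:
  "p \<in> paths (subtopology T U) \<longleftrightarrow> p \<in> paths T \<and> p ` {0..1} \<subseteq> U"
  by (auto simp: paths_def pathin_subtopology)

lemma dspace_subdspace:
  assumes "dspace X"
  shows "dspace (subdspace X U)"
  unfolding dspace_def
proof (intro conjI ballI allI impI)
  fix p q assume "p \<in> dpaths (subdspace X U)" "q \<in> dpaths (subdspace X U)" "p 1 = q 0"
  then show "path_concat p q \<in> dpaths (subdspace X U)"
    using dspaceD(3)[OF assms, of p q] by (auto simp: path_concat_def image_subset_iff)
next
  fix p \<phi> assume "p \<in> dpaths (subdspace X U)" "reparametrization \<phi>"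
  then show "compose {0..1} p \<phi> \<in> dpaths (subdspace X U)"
    using reparametrizationD(2)[of \<phi>]
    dspaceD(4)[OF assms, of p \<phi>] by (auto simp: compose_def image_subset_iff)
qed (use dspaceD[OF assms] in \<open>auto simp: paths_subtopology\<close>)

section \<open>The directed interval and weakly directed paths\<close>

lemma dpaths_dinterval:
  "p \<in> dpaths dinterval \<longleftrightarrow> p \<in> paths (top_of_set {0..1}) \<and> mono_on {0..1} p"
  by (simp add: dinterval_def)

lemma top_of_dinterval [simp]: "top_of dinterval = top_of_set {0..1}"
  by (simp add: dinterval_def)

text \<open>The preimage of \<open>U\<close> is covered by intervals on which the path stays in \<open>U\<close>, so it suffices to
  consider reparametrized paths lying entirely in \<open>U\<close>.\<close>

lemma weakly_directedI:
  assumes c: "c \<in> paths (top_of X)"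
    and mono: "\<And>U f \<phi>. openin (top_of X) U \<Longrightarrow> directed_function X U f \<Longrightarrow> reparametrization \<phi> \<Longrightarrow>
      compose {0..1} c \<phi> ` {0..1} \<subseteq> U \<Longrightarrow> mono_on {0..1} (\<lambda>s. f (c (\<phi> s)))"
  shows "weakly_directed X c"
  unfolding weakly_directed_def locally_nondecreasing_on_iff
proof (intro conjI allI impI ballI, rule c)
  fix U f t assume Uf: "openin (top_of X) U \<and> directed_function X U f"
    and t: "t \<in> {t \<in> {0..1}. c t \<in> U}"
  obtain e where "e > 0" and e: "\<And>s. s \<in> {0..1} \<Longrightarrow> \<bar>s - t\<bar> < e \<Longrightarrow> c s \<in> U"
    using paths_ball[OF c] Uf t by blast
  \<comment> \<open>With half the radius, the closed interval from \<open>a\<close> to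
    \<open>b\<close> stays in the open ball of radius \<open>e\<close>; it is cut off at 0 and 1.
    Even if \<open>t\<close> is 0 or 1 it is nondegenerate, so the affine map onto it can be
    inverted.\<close>
  define a b where "a = max 0 (t - e/2)" and "b = min 1 (t + e/2)"
  define \<phi> where "\<phi> = (\<lambda>s. a + (b - a) * s)"
  have ab: "0 \<le> a" "a < b" "b \<le> 1" "t - e/2 \<le> a" "b \<le> t + e/2"
    using t \<open>e > 0\<close> by (auto simp: a_def b_def)
  have \<phi>: "reparametrization \<phi>"
    unfolding \<phi>_def by (rule reparametrization_affine) (use ab in auto)
  have "c (\<phi> s) \<in> U" if s: "s \<in> {0..1}" for s
  proof (rule e)
    have "(b - a) * s \<le> (b - a) * 1" "0 \<le> (b - a) * s"
      using s ab(2) by (auto intro!: mult_left_mono simp del: mult_1_right)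
    then show "\<bar>\<phi> s - t\<bar> < e"
      using ab \<open>e > 0\<close> unfolding \<phi>_def abs_less_iff mult_1_right by linarith
  qed (rule reparametrizationD(2)[OF \<phi> s])
  then have m: "mono_on {0..1} (\<lambda>s. f (c (\<phi> s)))"
    using Uf \<phi> by (intro mono) (auto simp: compose_def)
  show "\<exists>d>0. \<forall>s\<in>{t \<in> {0..1}. c t \<in> U}. \<forall>s'\<in>{t \<in> {0..1}. c t \<in> U}.
      \<bar>s - t\<bar> < d \<longrightarrow> \<bar>s' - t\<bar> < d \<longrightarrow> s \<le> s' \<longrightarrow> (f \<circ> c) s \<le> (f \<circ> c) s'"
  proof (intro exI[of _ "e/2"] conjI ballI impI)
    fix s s' assume s: "s \<in> {t \<in> {0..1}. c t \<in> U}" "s' \<in> {t \<in> {0..1}. c t \<in> U}"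
      "\<bar>s - t\<bar> < e/2" "\<bar>s' - t\<bar> < e/2" "s \<le> s'"
    \<comment> \<open>The preimages of \<open>s\<close> and \<open>s'\<close> under the affine map,
      so that monotonicity of the reparametrized piece can be read off at the original
      times.\<close>
    define u v where "u = (s - a) / (b - a)" and "v = (s' - a) / (b - a)"
    have "t - e/2 < s" "s < t + e/2" "t - e/2 < s'" "s' < t + e/2" using s(3,4) by linarith+
    then have I: "s \<in> {a..b}" "s' \<in> {a..b}" using s(1,2) by (auto simp: a_def b_def)
    have "u \<in> {0..1}" "v \<in> {0..1}" "u \<le> v"
      using I ab s(5) by (auto simp: u_def v_def divide_simps)
    moreover have "\<phi> u = s" "\<phi> v = s'" using ab by (auto simp: u_def v_def \<phi>_def)
    ultimately show "(f \<circ> c) s \<le> (f \<circ> c) s'"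
      using mono_onD[OF m, of u v] by simp
  qed (use \<open>e > 0\<close> in auto)
qed

lemma weakly_directedD:
  assumes "weakly_directed X c" "openin (top_of X) U" "directed_function X U f"
    and "t \<in> {0..1}" "c t \<in> U"
  obtains e where "e > 0"
    "\<And>s s'. s \<in> {0..1} \<Longrightarrow> s' \<in> {0..1} \<Longrightarrow> c s \<in> U \<Longrightarrow> c s' \<in> U \<Longrightarrow>
       \<bar>s - t\<bar> < e \<Longrightarrow> \<bar>s' - t\<bar> < e \<Longrightarrow> s \<le> s' \<Longrightarrow> f (c s) \<le> f (c s')"
proof -
  have "locally_nondecreasing_on {t \<in> {0..1}. c t \<in> U} (f \<circ> c)"
    using assms(1-3) unfolding weakly_directed_def by blast
  then have "\<exists>e>0. \<forall>s\<in>{t \<in> {0..1}. c t \<in> U}. \<forall>s'\<in>{t \<in> {0..1}. c t \<in> U}.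
      \<bar>s - t\<bar> < e \<longrightarrow> \<bar>s' - t\<bar> < e \<longrightarrow> s \<le> s' \<longrightarrow> (f \<circ> c) s \<le> (f \<circ> c) s'"
    unfolding locally_nondecreasing_on_iff by (rule bspec) (use assms(4,5) in simp)
  then show ?thesis
    by (elim exE conjE) (rule that, auto)
qed

lemma weakly_directed_paths: "weakly_directed X c \<Longrightarrow> c \<in> paths (top_of X)"
  by (simp add: weakly_directed_def)

lemma directed_function_mono_on:
  assumes "directed_function X U f" "p \<in> dpaths X" "p ` {0..1} \<subseteq> U"
  shows "mono_on {0..1} (\<lambda>s. f (p s))"
proof -
  have "compose {0..1} f p \<in> dpaths dinterval"
    using assms by (intro dhomD(3)[OF assms(1)[unfolded directed_function_def]]) auto
  then show ?thesis
    by (auto simp: dpaths_dinterval compose_def mono_on_def)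
qed

text \<open>This makes the identity a morphism from a d-space to its image under L. Reparametrized
  pieces of a directed path are directed, so a directed function is non-decreasing along each piece
  inside its domain.\<close>

lemma dpaths_weakly_directed:
  assumes X: "dspace X" and p: "p \<in> dpaths X"
  shows "weakly_directed X p"
proof (rule weakly_directedI)
  show "p \<in> paths (top_of X)" by (rule dspaceD(1)[OF X p])
  fix U f \<phi> assume a: "directed_function X U f" "reparametrization \<phi>" "compose {0..1} p \<phi> ` {0..1} \<subseteq> U"
  have "mono_on {0..1} (\<lambda>s. f (compose {0..1} p \<phi> s))"
    by (rule directed_function_mono_on[OF a(1) dspaceD(4)[OF X p a(2)] a(3)])
  then show "mono_on {0..1} (\<lambda>s. f (p (\<phi> s)))"
    by (auto simp: mono_on_def compose_def)
qed

text \<open>Around a time \<open>t\<close>, one radius is found for pairs of times in the first half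
  and another for pairs in the second half. Pairs that straddle the junction matter only at
  \<open>t = 1/2\<close>, where the value at the junction is compared with both.\<close>

lemma weakly_directed_path_concat:
  assumes p: "weakly_directed X p" and q: "weakly_directed X q" and pq: "p 1 = q 0"
  shows "weakly_directed X (path_concat p q)"
  unfolding weakly_directed_def locally_nondecreasing_on_iff
proof (intro conjI allI impI ballI)
  let ?c = "path_concat p q"
  show "?c \<in> paths (top_of X)"
    using assms by (intro paths_path_concat weakly_directed_paths)
  fix U f t assume Uf: "openin (top_of X) U \<and> directed_function X U f"
    and t: "t \<in> {t \<in> {0..1}. ?c t \<in> U}"
  note cp = path_concat_apply(1)[of _ p q] and cq = path_concat_apply(2)[of p q, OF pq]
  have "\<exists>e>0. \<forall>s\<in>{0..1}. \<forall>s'\<in>{0..1}. ?c s \<in> U \<longrightarrow> ?c s' \<in> U \<longrightarrow> s' \<le> 1/2 \<longrightarrow>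
      \<bar>s - t\<bar> < e \<longrightarrow> \<bar>s' - t\<bar> < e \<longrightarrow> s \<le> s' \<longrightarrow> f (?c s) \<le> f (?c s')"
  proof (cases "t \<le> 1/2")
    case True
    then have pt: "2 * t \<in> {0..1}" "p (2 * t) \<in> U" using t by (auto simp: cp)
    obtain e where e: "e > 0"
      "\<And>s s'. s \<in> {0..1} \<Longrightarrow> s' \<in> {0..1} \<Longrightarrow> p s \<in> U \<Longrightarrow> p s' \<in> U \<Longrightarrow>
       \<bar>s - 2 * t\<bar> < e \<Longrightarrow> \<bar>s' - 2 * t\<bar> < e \<Longrightarrow> s \<le> s' \<Longrightarrow> f (p s) \<le> f (p s')"
      using weakly_directedD[OF p conjunct1[OF Uf] conjunct2[OF Uf] pt] by blast
    show ?thesis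
    \<comment> \<open>The concatenation runs through \<open>p\<close> at double speed, so half the
      radius suffices.\<close>
    proof (intro exI[of _ "e/2"] conjI ballI impI)
      fix s s' :: real assume s: "s \<in> {0..1}" "s' \<in> {0..1}" "?c s \<in> U" "?c s' \<in> U" "s' \<le> 1/2"
        "\<bar>s - t\<bar> < e/2" "\<bar>s' - t\<bar> < e/2" "s \<le> s'"
      have "\<bar>2 * s - 2 * t\<bar> < e" "\<bar>2 * s' - 2 * t\<bar> < e" using s(6,7) by linarith+
      with s e(2)[of "2 * s" "2 * s'"] show "f (?c s) \<le> f (?c s')" by (simp add: cp)
    qed (use e(1) in auto)
  next
    case False
    \<comment> \<open>With this radius no \<open>s'\<close> in the first half is close enough to
      \<open>t\<close>, so the claim is vacuous; the symmetric choice is made for the second half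
      below.\<close>
    then show ?thesis by (intro exI[of _ "t - 1/2"]) auto
  qed
  then obtain d where d: "d > 0" "\<And>s s'. s \<in> {0..1} \<Longrightarrow> s' \<in> {0..1} \<Longrightarrow> ?c s \<in> U \<Longrightarrow> ?c s' \<in> U \<Longrightarrow>
      s' \<le> 1/2 \<Longrightarrow> \<bar>s - t\<bar> < d \<Longrightarrow> \<bar>s' - t\<bar> < d \<Longrightarrow> s \<le> s' \<Longrightarrow> f (?c s) \<le> f (?c s')"
    by blast
  have "\<exists>e>0. \<forall>s\<in>{0..1}. \<forall>s'\<in>{0..1}. ?c s \<in> U \<longrightarrow> ?c s' \<in> U \<longrightarrow> 1/2 \<le> s \<longrightarrow>
      \<bar>s - t\<bar> < e \<longrightarrow> \<bar>s' - t\<bar> < e \<longrightarrow> s \<le> s' \<longrightarrow> f (?c s) \<le> f (?c s')"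
  proof (cases "1/2 \<le> t")
    case True
    then have qt: "2 * t - 1 \<in> {0..1}" "q (2 * t - 1) \<in> U" using t by (auto simp: cq)
    obtain e where e: "e > 0"
      "\<And>s s'. s \<in> {0..1} \<Longrightarrow> s' \<in> {0..1} \<Longrightarrow> q s \<in> U \<Longrightarrow> q s' \<in> U \<Longrightarrow>
       \<bar>s - (2 * t - 1)\<bar> < e \<Longrightarrow> \<bar>s' - (2 * t - 1)\<bar> < e \<Longrightarrow> s \<le> s' \<Longrightarrow> f (q s) \<le> f (q s')"
      using weakly_directedD[OF q conjunct1[OF Uf] conjunct2[OF Uf] qt] by blast
    show ?thesis
    proof (intro exI[of _ "e/2"] conjI ballI impI)
      fix s s' :: real assume s: "s \<in> {0..1}" "s' \<in> {0..1}" "?c s \<in> U" "?c s' \<in> U" "1/2 \<le> s"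
        "\<bar>s - t\<bar> < e/2" "\<bar>s' - t\<bar> < e/2" "s \<le> s'"
      have "\<bar>(2 * s - 1) - (2 * t - 1)\<bar> < e" "\<bar>(2 * s' - 1) - (2 * t - 1)\<bar> < e" using s(6,7) by linarith+
      with s e(2)[of "2 * s - 1" "2 * s' - 1"] show "f (?c s) \<le> f (?c s')" by (simp add: cq)
    qed (use e(1) in auto)
  next
    case False
    then show ?thesis by (intro exI[of _ "1/2 - t"]) auto
  qed
  then obtain d' where d': "d' > 0" "\<And>s s'. s \<in> {0..1} \<Longrightarrow> s' \<in> {0..1} \<Longrightarrow> ?c s \<in> U \<Longrightarrow> ?c s' \<in> U \<Longrightarrow>
      1/2 \<le> s \<Longrightarrow> \<bar>s - t\<bar> < d' \<Longrightarrow> \<bar>s' - t\<bar> < d' \<Longrightarrow> s \<le> s' \<Longrightarrow> f (?c s) \<le> f (?c s')"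
    by blast
  \<comment> \<open>Two times within \<open>r\<close> of \<open>t\<close> can lie strictly on
    opposite sides of 1/2 only if \<open>t = 1/2\<close>. In that case any positive radius would do,
    and 1 is taken.\<close>
  define r where "r = (if t = 1/2 then 1 else \<bar>t - 1/2\<bar>)"
  have r: "r > 0" by (auto simp: r_def)
  show "\<exists>e>0. \<forall>s\<in>{t \<in> {0..1}. ?c t \<in> U}. \<forall>s'\<in>{t \<in> {0..1}. ?c t \<in> U}.
      \<bar>s - t\<bar> < e \<longrightarrow> \<bar>s' - t\<bar> < e \<longrightarrow> s \<le> s' \<longrightarrow> (f \<circ> ?c) s \<le> (f \<circ> ?c) s'"
  proof (intro exI[of _ "min r (min d d')"] conjI ballI impI)
    fix s s' assume s: "s \<in> {t \<in> {0..1}. ?c t \<in> U}" "s' \<in> {t \<in> {0..1}. ?c t \<in> U}"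
      "\<bar>s - t\<bar> < min r (min d d')" "\<bar>s' - t\<bar> < min r (min d d')" "s \<le> s'"
    consider "s' \<le> 1/2" | "1/2 \<le> s" | "s < 1/2" "1/2 < s'" by linarith
    then show "(f \<circ> ?c) s \<le> (f \<circ> ?c) s'"
    proof cases
      case 1
      with s d(2)[of s s'] show ?thesis by simp
    next
      case 2
      with s d'(2)[of s s'] show ?thesis by simp
    next
      \<comment> \<open>The radius forces \<open>t = 1/2\<close>. Since the path is in
        \<open>U\<close> at time \<open>t\<close>, the value of \<open>f\<close> there can be
        inserted between the values at \<open>s\<close> and \<open>s'\<close>.\<close>
      case 3
      then have "t = 1/2" using s unfolding r_def by (auto simp: abs_less_iff split: if_splits)
      then have "t \<le> 1/2" "1/2 \<le> t" "s \<le> t" "t \<le> s'" using 3 by linarith+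
      then have "f (?c s) \<le> f (?c t)" "f (?c t) \<le> f (?c s')"
        using s t d(1) d'(1) d(2)[of s t] d'(2)[of t s'] by simp_all
      then show ?thesis by simp
    qed
  qed (use r d(1) d'(1) in auto)
qed

text \<open>Continuity of \<open>\<phi>\<close> brings nearby times into the neighbourhood of
  \<open>\<phi> t\<close> on which \<open>f\<close> along \<open>p\<close> is non-decreasing, and
  monotonicity of \<open>\<phi>\<close> preserves their order.\<close>

lemma weakly_directed_reparametrization:
  assumes p: "weakly_directed X p" and \<phi>: "reparametrization \<phi>"
  shows "weakly_directed X (compose {0..1} p \<phi>)"
  unfolding weakly_directed_def locally_nondecreasing_on_iff
proof (intro conjI allI impI ballI)
  let ?c = "compose {0..1} p \<phi>"
  show "?c \<in> paths (top_of X)"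
    using assms by (intro paths_reparametrization weakly_directed_paths)
  fix U f t assume Uf: "openin (top_of X) U \<and> directed_function X U f"
    and t: "t \<in> {t \<in> {0..1}. ?c t \<in> U}"
  note \<phi>D = reparametrizationD[OF \<phi>]
  have \<phi>t: "\<phi> t \<in> {0..1}" "p (\<phi> t) \<in> U" using t \<phi>D(2)[of t] by (auto simp: compose_eq)
  obtain e where e: "e > 0"
      "\<And>s s'. s \<in> {0..1} \<Longrightarrow> s' \<in> {0..1} \<Longrightarrow> p s \<in> U \<Longrightarrow> p s' \<in> U \<Longrightarrow>
       \<bar>s - \<phi> t\<bar> < e \<Longrightarrow> \<bar>s' - \<phi> t\<bar> < e \<Longrightarrow> s \<le> s' \<Longrightarrow> f (p s) \<le> f (p s')"
    using weakly_directedD[OF p conjunct1[OF Uf] conjunct2[OF Uf] \<phi>t] by blast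
  obtain d where d: "d > 0" "\<And>s. s \<in> {0..1} \<Longrightarrow> \<bar>s - t\<bar> < d \<Longrightarrow> \<bar>\<phi> s - \<phi> t\<bar> < e"
    using \<phi>D(1) t e(1) unfolding continuous_on_iff dist_real_def by blast
  show "\<exists>d>0. \<forall>s\<in>{t \<in> {0..1}. ?c t \<in> U}. \<forall>s'\<in>{t \<in> {0..1}. ?c t \<in> U}.
      \<bar>s - t\<bar> < d \<longrightarrow> \<bar>s' - t\<bar> < d \<longrightarrow> s \<le> s' \<longrightarrow> (f \<circ> ?c) s \<le> (f \<circ> ?c) s'"
  proof (intro exI[of _ d] conjI ballI impI d(1))
    fix s s' assume s: "s \<in> {t \<in> {0..1}. ?c t \<in> U}" "s' \<in> {t \<in> {0..1}. ?c t \<in> U}"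
      "\<bar>s - t\<bar> < d" "\<bar>s' - t\<bar> < d" "s \<le> s'"
    then have s01: "s \<in> {0..1}" "s' \<in> {0..1}" by auto
    with s have "p (\<phi> s) \<in> U" "p (\<phi> s') \<in> U" by (auto simp: compose_eq)
    with s s01 have "f (p (\<phi> s)) \<le> f (p (\<phi> s'))"
      using \<phi>D(2) d(2) by (intro e(2) mono_onD[OF \<phi>D(3)])
    with s show "(f \<circ> ?c) s \<le> (f \<circ> ?c) s'" by (simp add: compose_eq)
  qed
qed

section \<open>The functor L\<close>

lemma L_functor_simps [simp]:
  "top_of (Ob L_functor X) = top_of X"
  "dpaths (Ob L_functor X) = {c. weakly_directed X c}"
  "Ar L_functor X Y f = f"
  by (simp_all add: L_functor_def)

lemma dspace_L_functor:
  assumes "dspace X"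
  shows "dspace (Ob L_functor X)"
  unfolding dspace_def L_functor_simps mem_Collect_eq
  using dpaths_weakly_directed[OF assms dspaceD(2)[OF assms]]
    weakly_directed_path_concat[of X] weakly_directed_reparametrization[of X]
    weakly_directed_paths[of X]
  by blast

text \<open>The morphism \<open>f\<close> restricts to a morphism from the subspace on the preimage
  of \<open>U\<close> to the subspace on \<open>U\<close>, and this is composed with
  \<open>g\<close>.\<close>

lemma directed_function_pullback:
  assumes X: "dspace X" and f: "f \<in> dhom X Y" and g: "directed_function Y U g"
  shows "directed_function X {x \<in> carrier X. f x \<in> U}
    (compose {x \<in> carrier X. f x \<in> U} g f)"
proof -
  let ?V = "{x \<in> carrier X. f x \<in> U}"
  have V: "carrier (subdspace X ?V) = ?V" by auto
  have "restrict f ?V \<in> dhom (subdspace X ?V) (subdspace Y U)"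
    unfolding dhom_def
  proof (intro CollectI conjI ballI)
    show "continuous_map (top_of (subdspace X ?V)) (top_of (subdspace Y U)) (restrict f ?V)"
      using dhomD(2)[OF f]
      by (auto simp: continuous_map_in_subtopology Pi_iff
          intro!: continuous_map_eq[OF continuous_map_from_subtopology])
    fix p assume p: "p \<in> dpaths (subdspace X ?V)"
    then have "compose {0..1} (restrict f ?V) p = compose {0..1} f p"
      by (auto simp: compose_def fun_eq_iff restrict_def image_subset_iff)
    with p dhomD(3)[OF f, of p] show "compose {0..1} (restrict f ?V) p \<in> dpaths (subdspace Y U)"
      by (auto simp: compose_def)
  qed auto
  from dhom_compose[OF this g[unfolded directed_function_def]] dspaceD(1)[OF dspace_subdspace[OF X]]
  have "compose ?V g (restrict f ?V) \<in> dhom (subdspace X ?V) dinterval"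
    unfolding V by blast
  moreover have "compose ?V g (restrict f ?V) = compose ?V g f"
    by (auto simp: compose_def)
  ultimately show ?thesis by (simp add: directed_function_def)
qed

text \<open>Functoriality of L. Testing the image path against \<open>g\<close> on \<open>U\<close>
  amounts to testing \<open>c\<close> against the pullback of \<open>g\<close> on the open preimage
  of \<open>U\<close>.\<close>

lemma weakly_directed_dhom:
  assumes X: "dspace X" and f: "f \<in> dhom X Y" and c: "weakly_directed X c"
  shows "weakly_directed Y (compose {0..1} f c)"
  unfolding weakly_directed_def locally_nondecreasing_on_iff
proof (intro conjI allI impI ballI)
  let ?c = "compose {0..1} f c"
  have cp: "c \<in> paths (top_of X)" by (rule weakly_directed_paths[OF c])
  show "?c \<in> paths (top_of Y)"
    by (rule paths_compose[OF cp dhomD(2)[OF f]])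
  fix U g t assume Ug: "openin (top_of Y) U \<and> directed_function Y U g"
    and t: "t \<in> {t \<in> {0..1}. ?c t \<in> U}"
  define V where "V = {x \<in> carrier X. f x \<in> U}"
  have V: "openin (top_of X) V"
    unfolding V_def using Ug dhomD(2)[OF f] by (auto intro: openin_continuous_map_preimage)
  \<comment> \<open>The path \<open>c\<close> stays in the carrier, so the two tests concern the
    same set of times.\<close>
  have in_V: "c s \<in> V \<longleftrightarrow> ?c s \<in> U" if "s \<in> {0..1}" for s
    using that paths_in_topspace[OF cp that] by (auto simp: V_def compose_eq)
  have ct: "t \<in> {0..1}" "c t \<in> V" using t in_V by auto
  obtain e where e: "e > 0"
      "\<And>s s'. s \<in> {0..1} \<Longrightarrow> s' \<in> {0..1} \<Longrightarrow> c s \<in> V \<Longrightarrow> c s' \<in> V \<Longrightarrow>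
       \<bar>s - t\<bar> < e \<Longrightarrow> \<bar>s' - t\<bar> < e \<Longrightarrow> s \<le> s' \<Longrightarrow> compose V g f (c s) \<le> compose V g f (c s')"
    using weakly_directedD[OF c V directed_function_pullback[OF X f conjunct2[OF Ug], folded V_def] ct]
    by blast
  show "\<exists>d>0. \<forall>s\<in>{t \<in> {0..1}. ?c t \<in> U}. \<forall>s'\<in>{t \<in> {0..1}. ?c t \<in> U}.
      \<bar>s - t\<bar> < d \<longrightarrow> \<bar>s' - t\<bar> < d \<longrightarrow> s \<le> s' \<longrightarrow> (g \<circ> ?c) s \<le> (g \<circ> ?c) s'"
  proof (intro exI[of _ e] conjI ballI impI e(1))
    fix s s' assume s: "s \<in> {t \<in> {0..1}. ?c t \<in> U}" "s' \<in> {t \<in> {0..1}. ?c t \<in> U}"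
      "\<bar>s - t\<bar> < e" "\<bar>s' - t\<bar> < e" "s \<le> s'"
    then have "c s \<in> V" "c s' \<in> V" using in_V by auto
    with s e(2)[of s s'] show "(g \<circ> ?c) s \<le> (g \<circ> ?c) s'" by (simp add: compose_eq)
  qed
qed

lemma endofunctor_L_functor: "endofunctor L_functor"
  unfolding endofunctor_def
proof (intro conjI allI impI)
  fix X Y :: "'a dspace" and f assume a: "dspace X \<and> dspace Y \<and> f \<in> dhom X Y"
  then have f: "f \<in> dhom X Y" and X: "dspace X" by blast+
  from weakly_directed_dhom[OF X f] dhomD(1,2)[OF f]
  have "f \<in> dhom (Ob L_functor X) (Ob L_functor Y)"
    unfolding dhom_def L_functor_simps by blast
  then show "Ar L_functor X Y f \<in> dhom (Ob L_functor X) (Ob L_functor Y)" by simp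
qed (simp_all add: dspace_L_functor id_map_def)

text \<open>As \<open>S\<close> leaves underlying maps unchanged, both composites in the naturality
  square are \<open>f\<close> on the carrier; the inclusion of directed paths makes the components
  morphisms.\<close>

lemma natural_from_id_id_map:
  fixes S :: "'u dfunctor"
  assumes "commutes_with_forgetful S"
    and "\<And>X. dspace X \<Longrightarrow> dpaths X \<subseteq> dpaths (Ob S X)"
    and "\<And>X. dspace X \<Longrightarrow> \<eta> X = id_map X"
  shows "natural_from_id S \<eta>"
  unfolding natural_from_id_def
proof (intro conjI allI impI)
  fix X :: "'u dspace" assume X: "dspace X"
  show "\<eta> X \<in> dhom X (Ob S X)"
    unfolding assms(3)[OF X]
  proof (rule id_map_dhom)
    show "top_of X = top_of (Ob S X)" using assms(1) X unfolding commutes_with_forgetful_def by metis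
    show "dpaths X \<subseteq> paths (top_of X)" using dspaceD(1)[OF X] by blast
  qed (rule assms(2)[OF X])
next
  fix X Y :: "'u dspace" and f assume a: "dspace X \<and> dspace Y \<and> f \<in> dhom X Y"
  then have "Ar S X Y f = f" using assms(1) unfolding commutes_with_forgetful_def by blast
  moreover have "compose (carrier X) f (id_map X) = compose (carrier X) (id_map Y) f"
    using a dhomD(4)[of f X Y] by (auto simp: compose_def id_map_def fun_eq_iff restrict_def)
  ultimately show "compose (carrier X) (Ar S X Y f) (\<eta> X) = compose (carrier X) (\<eta> Y) f"
    using a assms(3) by simp
qed

section \<open>The copy of the directed interval in the universe\<close>

lemma topspace_dinterval_in:
  assumes "inj_on \<iota> {0..1}"
  shows "carrier (dinterval_in \<iota>) = \<iota> ` {0..1}"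
  using assms by (auto simp: dinterval_in_def topspace_pullback_topology)

lemma continuous_map_inv_dinterval_in:
  "continuous_map (top_of (dinterval_in \<iota>)) (top_of_set {0..1}) (inv_into {0..1} \<iota>)"
  using continuous_map_pullback[OF continuous_map_id, of "\<iota> ` {0..1}" "inv_into {0..1} \<iota>" "top_of_set {0..1}"]
  by (simp add: dinterval_in_def)

text \<open>Universal property of the pullback topology: continuity is tested after applying the
  inverse of \<open>\<iota>\<close>, which gives back \<open>f\<close>.\<close>

lemma continuous_map_into_dinterval_in:
  assumes \<iota>: "inj_on \<iota> {0..1}" and f: "continuous_map T (top_of_set {0..1}) f"
  shows "continuous_map T (top_of (dinterval_in \<iota>)) (\<iota> \<circ> f)"
proof -
  have f01: "f x \<in> {0..1}" if "x \<in> topspace T" for x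
    using f that by (auto simp: continuous_map_def)
  then have "continuous_map T (top_of_set {0..1}) (inv_into {0..1} \<iota> \<circ> (\<iota> \<circ> f))"
    using \<iota> by (intro continuous_map_eq[OF f]) auto
  then show ?thesis
    using f01 by (auto simp: dinterval_in_def intro!: continuous_map_pullback')
qed

text \<open>Replaces the witness hidden in the image by a condition on the path itself, with the
  inverse of \<open>\<iota>\<close> as coordinate.\<close>

lemma dpaths_dinterval_in:
  assumes \<iota>: "inj_on \<iota> {0..1}"
  shows "p \<in> dpaths (dinterval_in \<iota>) \<longleftrightarrow>
    p \<in> paths (top_of (dinterval_in \<iota>)) \<and> mono_on {0..1} (\<lambda>t. inv_into {0..1} \<iota> (p t))"
    (is "?L \<longleftrightarrow> ?R")
proof
  assume ?L
  then obtain q where q: "q \<in> paths (top_of_set {0..1})" "mono_on {0..1} q"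
    and p: "p = compose {0..1} \<iota> q"
    by (auto simp: dinterval_in_def dpaths_dinterval)
  have q01: "q t \<in> {0..1}" if "t \<in> {0..1}" for t
    using paths_in_topspace[OF q(1) that] by simp
  have "continuous_map (top_of_set {0..1}) (top_of (dinterval_in \<iota>)) (\<iota> \<circ> q)"
    using q(1) by (intro continuous_map_into_dinterval_in[OF \<iota>]) (simp add: paths_def pathin_def)
  then have "p \<in> paths (top_of (dinterval_in \<iota>))"
    unfolding p paths_def pathin_def by (auto simp: compose_def intro: continuous_map_eq)
  moreover have "mono_on {0..1} (\<lambda>t. inv_into {0..1} \<iota> (p t))"
    using q(2) q01 \<iota> by (auto simp: mono_on_def p compose_def)
  ultimately show ?R by blast
next
  assume R: ?R
  let ?q = "compose {0..1} (inv_into {0..1} \<iota>) p"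
  have "?q \<in> dpaths dinterval"
    unfolding dpaths_dinterval using R paths_compose[OF _ continuous_map_inv_dinterval_in, of p]
    by (auto simp: mono_on_def compose_eq)
  moreover have "p = compose {0..1} \<iota> ?q"
  proof (rule extensionalityI)
    fix t :: real assume t: "t \<in> {0..1}"
    then have "p t \<in> \<iota> ` {0..1}"
      using R paths_in_topspace topspace_dinterval_in[OF \<iota>] by blast
    with t show "p t = compose {0..1} \<iota> ?q t" by (simp add: compose_eq f_inv_into_f)
  qed (use R in \<open>auto simp: paths_def\<close>)
  ultimately show ?L by (auto simp: dinterval_in_def)
qed

lemma dspace_dinterval_in:
  assumes \<iota>: "inj_on \<iota> {0..1}"
  shows "dspace (dinterval_in \<iota>)"
  unfolding dspace_def
proof (intro conjI ballI allI impI)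
  fix x assume "x \<in> carrier (dinterval_in \<iota>)"
  then show "(\<lambda>t\<in>{0..1}. x) \<in> dpaths (dinterval_in \<iota>)"
    by (auto simp: dpaths_dinterval_in[OF \<iota>] paths_const mono_on_def)
next
  fix p \<phi> assume "p \<in> dpaths (dinterval_in \<iota>)" "reparametrization \<phi>"
  then show "compose {0..1} p \<phi> \<in> dpaths (dinterval_in \<iota>)"
    using reparametrizationD[of \<phi>]
    by (auto simp: dpaths_dinterval_in[OF \<iota>] paths_reparametrization mono_on_def compose_eq)
next
  fix p q assume pq: "p \<in> dpaths (dinterval_in \<iota>)" "q \<in> dpaths (dinterval_in \<iota>)" "p 1 = q 0"
  let ?j = "inv_into {0..1} \<iota>" and ?c = "path_concat p q"
  have mp: "?j (p s) \<le> ?j (p s')" and mq: "?j (q s) \<le> ?j (q s')"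
    if "s \<in> {0..1}" "s' \<in> {0..1}" "s \<le> s'" for s s'
    using pq that by (auto simp: dpaths_dinterval_in[OF \<iota>] mono_on_def)
  have "?j (?c s) \<le> ?j (?c s')" if s: "s \<in> {0..1}" "s' \<in> {0..1}" "s \<le> s'" for s s'
  proof -
    consider "s' \<le> 1/2" | "1/2 \<le> s" | "s < 1/2" "1/2 < s'" by linarith
    then show ?thesis
    proof cases
      case 1 then show ?thesis using s by (auto simp: path_concat_apply(1) intro!: mp)
    next
      case 2 then show ?thesis using s by (auto simp: path_concat_apply(2)[of p q, OF pq(3)] intro!: mq)
    next
      \<comment> \<open>The two inequalities chain through the junction value
        \<open>p 1 = q 0\<close>.\<close>
      case 3
      have "?j (p (2 * s)) \<le> ?j (p 1)" "?j (q 0) \<le> ?j (q (2 * s' - 1))"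
        using s 3 by (auto intro!: mp mq)
      then show ?thesis using 3 s pq(3) by (auto simp: path_concat_def)
    qed
  qed
  with pq show "?c \<in> dpaths (dinterval_in \<iota>)"
    by (auto simp: dpaths_dinterval_in[OF \<iota>] intro!: paths_path_concat mono_onI)
qed (auto simp: dpaths_dinterval_in[OF \<iota>])

text \<open>The coordinate, defined on the whole copy, is the one test function needed to show that
  L fixes the interval.\<close>

lemma directed_function_inv_dinterval_in:
  assumes \<iota>: "inj_on \<iota> {0..1}"
  shows "directed_function (dinterval_in \<iota>) (\<iota> ` {0..1}) (\<lambda>x\<in>\<iota> ` {0..1}. inv_into {0..1} \<iota> x)"
  unfolding directed_function_def dhom_def
proof (intro CollectI conjI ballI)
  let ?A = "\<iota> ` {0..1}" and ?j = "inv_into {0..1} \<iota>"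
  have A: "carrier (subdspace (dinterval_in \<iota>) ?A) = ?A"
    by (simp add: topspace_dinterval_in[OF \<iota>])
  show "restrict ?j ?A \<in> extensional (carrier (subdspace (dinterval_in \<iota>) ?A))"
    unfolding A by simp
  show "continuous_map (top_of (subdspace (dinterval_in \<iota>) ?A)) (top_of dinterval) (restrict ?j ?A)"
    unfolding top_of_dinterval subdspace_simps
    by (rule continuous_map_eq[OF continuous_map_from_subtopology[OF continuous_map_inv_dinterval_in]]) auto
  fix p assume "p \<in> dpaths (subdspace (dinterval_in \<iota>) ?A)"
  then have p: "p \<in> paths (top_of (dinterval_in \<iota>))" "mono_on {0..1} (\<lambda>t. ?j (p t))" "p ` {0..1} \<subseteq> ?A"
    by (auto simp: dpaths_dinterval_in[OF \<iota>])
  have "compose {0..1} (restrict ?j ?A) p = compose {0..1} ?j p"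
    using p(3) by (auto simp: compose_def fun_eq_iff restrict_def image_subset_iff)
  moreover have "compose {0..1} ?j p \<in> dpaths dinterval"
    unfolding dpaths_dinterval using p(1,2) paths_compose[OF _ continuous_map_inv_dinterval_in, of p]
    by (auto simp: mono_on_def compose_eq)
  ultimately show "compose {0..1} (restrict ?j ?A) p \<in> dpaths dinterval" by simp
qed

text \<open>Tested against the coordinate, whose domain is the whole carrier, a weakly directed path
  has a coordinate that is locally non-decreasing on all of the unit interval, hence
  non-decreasing.\<close>

lemma L_functor_dinterval_in:
  assumes \<iota>: "inj_on \<iota> {0..1}"
  shows "Ob L_functor (dinterval_in \<iota>) = dinterval_in \<iota>"
proof (rule prod_eqI)
  show "dpaths (Ob L_functor (dinterval_in \<iota>)) = dpaths (dinterval_in \<iota>)"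
  proof (intro equalityI subsetI)
    fix c assume "c \<in> dpaths (Ob L_functor (dinterval_in \<iota>))"
    then have c: "weakly_directed (dinterval_in \<iota>) c" by simp
    let ?A = "\<iota> ` {0..1}" and ?j = "inv_into {0..1} \<iota>"
    have "openin (top_of (dinterval_in \<iota>)) ?A"
      using openin_topspace[of "top_of (dinterval_in \<iota>)"] by (simp add: topspace_dinterval_in[OF \<iota>])
    then have "locally_nondecreasing_on {t \<in> {0..1}. c t \<in> ?A} (restrict ?j ?A \<circ> c)"
      using c directed_function_inv_dinterval_in[OF \<iota>] unfolding weakly_directed_def by blast
    moreover have cA: "c t \<in> ?A" if "t \<in> {0..1}" for t
      using paths_in_topspace[OF weakly_directed_paths[OF c] that] by (simp add: topspace_dinterval_in[OF \<iota>])
    then have "{t \<in> {0..1}. c t \<in> ?A} = {0..1}" by blast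
    ultimately have "mono_on {0..1} (restrict ?j ?A \<circ> c)"
      using locally_nondecreasing_on_imp_mono_on by metis
    then have "mono_on {0..1} (\<lambda>t. ?j (c t))"
      using cA by (simp add: mono_on_def)
    with weakly_directed_paths[OF c] show "c \<in> dpaths (dinterval_in \<iota>)"
      by (simp add: dpaths_dinterval_in[OF \<iota>])
  qed (simp add: dpaths_weakly_directed[OF dspace_dinterval_in[OF \<iota>]])
qed simp

section \<open>L is a d-saturation process\<close>

text \<open>Because \<open>Y\<close> is open, an open subset of \<open>Y\<close> is open in
  \<open>X\<close>, and it inherits the same structure from either space. Hence every test function
  for the subspace is already a test function for \<open>X\<close>.\<close>

lemma weakly_directed_subdspace:
  assumes p: "weakly_directed X p" and Y: "openin (top_of X) Y" and im: "p ` {0..1} \<subseteq> Y"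
  shows "weakly_directed (subdspace X Y) p"
  unfolding weakly_directed_def
proof (intro conjI allI impI)
  show "p \<in> paths (top_of (subdspace X Y))"
    using weakly_directed_paths[OF p] im by (simp add: paths_subtopology)
  fix U f assume a: "openin (top_of (subdspace X Y)) U \<and> directed_function (subdspace X Y) U f"
  then have U: "openin (top_of X) U" "U \<subseteq> Y"
    using Y by (auto simp: openin_open_subtopology)
  have "subdspace (subdspace X Y) U = subdspace X U"
    using U(2) by (auto simp: subdspace_def subtopology_subtopology Int_absorb1)
  with a have "directed_function X U f" by (simp add: directed_function_def)
  with U p show "locally_nondecreasing_on {t \<in> {0..1}. p t \<in> U} (f \<circ> p)"
    unfolding weakly_directed_def by blast
qed

lemma d_saturation_process_L_functor:
  assumes \<iota>: "inj_on \<iota> {0..1}"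
  shows "d_saturation_process \<iota> L_functor L_unit"
proof -
  have c: "commutes_with_forgetful L_functor"
    by (simp add: commutes_with_forgetful_def)
  then have "natural_from_id L_functor L_unit"
    by (rule natural_from_id_id_map) (simp_all add: L_unit_def dpaths_weakly_directed subsetI)
  with c show ?thesis
    unfolding d_saturation_process_def L_functor_dinterval_in[OF \<iota>]
    by (intro conjI allI impI endofunctor_L_functor)
       (simp_all add: L_unit_def weakly_directed_subdspace)
qed

section \<open>Maximality of L\<close>

text \<open>A directed function takes real values, while \<open>S\<close> acts on morphisms between
  d-spaces over the universe type. Composition with \<open>\<iota>\<close> turns it into such a
  morphism.\<close>

lemma directed_function_dhom_dinterval_in:
  assumes \<iota>: "inj_on \<iota> {0..1}" and X: "dspace X" and f: "directed_function X U f"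
  shows "compose (carrier (subdspace X U)) \<iota> f \<in> dhom (subdspace X U) (dinterval_in \<iota>)"
  unfolding dhom_def
proof (intro CollectI conjI ballI)
  let ?V = "subdspace X U"
  note f' = dhomD[OF f[unfolded directed_function_def]]
  have "continuous_map (top_of ?V) (top_of (dinterval_in \<iota>)) (\<iota> \<circ> f)"
    by (rule continuous_map_into_dinterval_in[OF \<iota> f'(2)[unfolded top_of_dinterval]])
  then show "continuous_map (top_of ?V) (top_of (dinterval_in \<iota>)) (compose (carrier ?V) \<iota> f)"
    by (rule continuous_map_eq) (simp add: compose_eq)
  fix p assume p: "p \<in> dpaths ?V"
  have "p t \<in> carrier ?V" if "t \<in> {0..1}" for t
    using dspaceD(1)[OF dspace_subdspace[OF X] p] that by (rule paths_in_topspace)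
  then have "compose {0..1} (compose (carrier ?V) \<iota> f) p = compose {0..1} \<iota> (compose {0..1} f p)"
    by (auto simp: compose_def fun_eq_iff restrict_def)
  with f'(3)[OF p] show "compose {0..1} (compose (carrier ?V) \<iota> f) p \<in> dpaths (dinterval_in \<iota>)"
    by (auto simp: dinterval_in_def)
qed auto

text \<open>Since \<open>Ar S\<close> returns \<open>f\<close> itself, functoriality says that the
  same map remains a morphism after \<open>S\<close> is applied to source and target.\<close>

lemma d_saturation_processD:
  assumes "d_saturation_process \<iota> S \<eta>"
  shows "dspace X \<Longrightarrow> dspace (Ob S X)"
    and "dspace X \<Longrightarrow> top_of (Ob S X) = top_of X"
    and "dspace X \<Longrightarrow> dspace Y \<Longrightarrow> f \<in> dhom X Y \<Longrightarrow> f \<in> dhom (Ob S X) (Ob S Y)"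
    and "Ob S (dinterval_in \<iota>) = dinterval_in \<iota>"
    and "dspace X \<Longrightarrow> openin (top_of X) U \<Longrightarrow> p \<in> dpaths (Ob S X) \<Longrightarrow> p ` {0..1} \<subseteq> U \<Longrightarrow>
      p \<in> dpaths (Ob S (subdspace X U))"
proof -
  have endo: "endofunctor S" and forget: "commutes_with_forgetful S"
    using assms unfolding d_saturation_process_def by blast+
  show "dspace X \<Longrightarrow> dspace (Ob S X)"
    using endo unfolding endofunctor_def by blast
  show "dspace X \<Longrightarrow> top_of (Ob S X) = top_of X"
    using forget unfolding commutes_with_forgetful_def by blast
  show "f \<in> dhom (Ob S X) (Ob S Y)" if "dspace X" "dspace Y" "f \<in> dhom X Y"
  proof -
    have "Ar S X Y f \<in> dhom (Ob S X) (Ob S Y)"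
      using endo that unfolding endofunctor_def by blast
    moreover have "Ar S X Y f = f"
      using forget that unfolding commutes_with_forgetful_def by blast
    ultimately show ?thesis by simp
  qed
  show "Ob S (dinterval_in \<iota>) = dinterval_in \<iota>"
    using assms unfolding d_saturation_process_def by blast
  show "dspace X \<Longrightarrow> openin (top_of X) U \<Longrightarrow> p \<in> dpaths (Ob S X) \<Longrightarrow> p ` {0..1} \<subseteq> U \<Longrightarrow>
      p \<in> dpaths (Ob S (subdspace X U))"
    using assms unfolding d_saturation_process_def by blast
qed

lemma d_saturation_process_dpaths_weakly_directed:
  assumes \<iota>: "inj_on \<iota> {0..1}" and S: "d_saturation_process \<iota> S \<eta>"
    and X: "dspace X" and p: "p \<in> dpaths (Ob S X)"
  shows "weakly_directed X p"
proof (rule weakly_directedI)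
  note SX = d_saturation_processD(1,2)[OF S X]
  show "p \<in> paths (top_of X)" using dspaceD(1)[OF SX(1) p] SX(2) by simp
  fix U f \<phi> assume U: "openin (top_of X) U" and f: "directed_function X U f"
    and \<phi>: "reparametrization \<phi>" and im: "compose {0..1} p \<phi> ` {0..1} \<subseteq> U"
  let ?V = "subdspace X U" and ?q = "compose {0..1} p \<phi>"
  let ?g = "compose (carrier ?V) \<iota> f"
  have V: "dspace ?V" by (rule dspace_subdspace[OF X])
  \<comment> \<open>Closure under reparametrization makes the piece directed in
    \<open>Ob S X\<close>; locality on the open set \<open>U\<close> then moves it to the
    subspace.\<close>
  have q: "?q \<in> dpaths (Ob S ?V)"
    by (rule d_saturation_processD(5)[OF S X U dspaceD(4)[OF SX(1) p \<phi>] im])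
  \<comment> \<open>The target given by functoriality is the image of the interval under
    \<open>S\<close>, which is the interval again.\<close>
  have "?g \<in> dhom (Ob S ?V) (dinterval_in \<iota>)"
    using d_saturation_processD(3)[OF S V dspace_dinterval_in[OF \<iota>]
        directed_function_dhom_dinterval_in[OF \<iota> X f]]
    unfolding d_saturation_processD(4)[OF S] .
  from dhomD(3)[OF this q]
  have m: "mono_on {0..1} (\<lambda>t. inv_into {0..1} \<iota> (compose {0..1} ?g ?q t))"
    by (simp add: dpaths_dinterval_in[OF \<iota>])
  \<comment> \<open>\<open>\<iota>\<close> is injective only on the unit interval, so cancelling it
    requires that the value of \<open>f\<close> lies there.\<close>
  have "inv_into {0..1} \<iota> (compose {0..1} ?g ?q t) = f (p (\<phi> t))" if t: "t \<in> {0..1}" for t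
  proof -
    have "p (\<phi> t) \<in> topspace (top_of X)"
      using paths_in_topspace[OF dspaceD(1)[OF SX(1) p] reparametrizationD(2)[OF \<phi> t]] SX(2) by simp
    moreover have "p (\<phi> t) \<in> U" using im t by (auto simp: compose_def)
    ultimately have V: "p (\<phi> t) \<in> carrier ?V" by simp
    then have "f (p (\<phi> t)) \<in> {0..1}"
      using dhomD(4)[OF f[unfolded directed_function_def] V] by simp
    with V t \<iota> show ?thesis by (simp add: compose_eq del: subdspace_simps)
  qed
  with m show "mono_on {0..1} (\<lambda>s. f (p (\<phi> s)))" by (simp add: mono_on_def)
qed

theorem theorem6p5:
  fixes \<iota> :: "real \<Rightarrow> 'u"
  assumes "inj_on \<iota> {0..1}"
  shows "d_saturation_process \<iota> L_functor L_unit \<and>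
    (\<forall>S \<eta>. d_saturation_process \<iota> S \<eta> \<longrightarrow> saturation_le S L_functor)"
proof (intro conjI allI impI)
  show "d_saturation_process \<iota> L_functor L_unit"
    by (rule d_saturation_process_L_functor[OF assms])
  fix S :: "'u dfunctor" and \<eta> assume S: "d_saturation_process \<iota> S \<eta>"
  show "saturation_le S L_functor"
    unfolding saturation_le_def
  proof (intro allI impI)
    fix X :: "'u dspace" assume X: "dspace X"
    note SX = d_saturation_processD(1,2)[OF S X]
    \<comment> \<open>The identity is first taken with source \<open>Ob S X\<close>, where it is a
      morphism by inclusion of directed paths. It equals \<open>id_map X\<close> because
      \<open>S\<close> preserves the topology and hence the carrier.\<close>
    then have "id_map (Ob S X) \<in> dhom (Ob S X) (Ob L_functor X)"
      using d_saturation_process_dpaths_weakly_directed[OF assms S X] dspaceD(1)[of "Ob S X"]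
      by (intro id_map_dhom) auto
    with SX(2) show "id_map X \<in> dhom (Ob S X) (Ob L_functor X)"
      by (simp add: id_map_def)
  qed
qed

end
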